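(* Let $X\in\mathbb{R}^{n\times p}$ be a fixed design matrix, $\beta^0\in\mathbb{R}^p$ the true coefficient vector and $\lambda>0$. Let $S=\{j:\beta^0_j\ne0\}$ be the (fixed) true active set and $s=|S|$. Let $L>0$ and suppose the strong restricted eigenvalue satisfies $\phi_{str}(L,S,s)>0$. If $\beta^\star$ is a solution of the noiseless Lasso problem $$\min_{\beta\in\mathbb{R}^p}\ \Big\{\tfrac1n\|X\beta-X\beta^0\|_2^2+\lambda\|\beta\|_1\Big\},$$ then $$\|\beta^\star-\beta^0\|_2^2\le\frac{s\lambda^2}{\phi_{str}^4(L,S,s)} .$$
   Context: For $\Delta\in\mathbb{R}^p$ and $S\subset\{1,\dots,p\}$, $\Delta_S\in\mathbb{R}^p$ agrees with $\Delta$ on $S$ and is zero outside $S$; $S^c$ is the complement of $S$. $\|\cdot\|_1,\|\cdot\|_2$ are the usual $\ell_1,\ell_2$ norms. For a set $S$ with cardinality $s=|S|$ and a constant $L>0$, the $(L,S,s)$-strong restricted eigenvalue $\phi_{str}(L,S,s)\ge0$ is defined by $$\phi_{str}^2(L,S,s)=\min\Big\{\frac{\frac1n\|X\Delta\|_2^2}{\|\Delta\|_2^2}:\ \Delta\in\mathbb{R}^p,\ \|\Delta_{S^c}\|_1\le L\|\Delta_S\|_1\ne0\Big\},$$ and $\phi_{str}^4=(\phi_{str}^2)^2$.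
   Formalization: The formal theorem assumes L ≥ 1 instead of L > 0: for L < 1 the claim fails, e.g. n=1, p=2, X=(1 2), β⁰=(1,0), L=1/4, λ=1/10 gives β*=(0,39/80), squared error > 1 but bound < 0.19. Also, φ_str > 0 is required only when S is nonempty. *)

theory Defs
  imports "HOL-Analysis.Analysis"
begin

definition l1_norm :: "real ^ 'p \<Rightarrow> real" where
  "l1_norm v = (\<Sum>j\<in>UNIV. \<bar>v $ j\<bar>)"

definition vec_on :: "'p set \<Rightarrow> real ^ 'p \<Rightarrow> real ^ 'p" where
  "vec_on S v = (\<chi> j. if j \<in> S then v $ j else 0)"

definition active_set :: "real ^ 'p \<Rightarrow> 'p set" where
  "active_set b = {j. b $ j \<noteq> 0}"

definition re_cone :: "real \<Rightarrow> 'p set \<Rightarrow> (real ^ 'p) set" where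
  "re_cone L S = {d. l1_norm (vec_on (- S) d) \<le> L * l1_norm (vec_on S d)
                     \<and> l1_norm (vec_on S d) \<noteq> 0}"

(* The (L,S,s)-strong restricted eigenvalue; s is card S and hence not a separate argument.
   For nonempty S the infimum is a minimum: the quotient is invariant under scaling of d, and
   the vectors of the cone with norm 1 form a nonempty compact set (for norm 1, a vanishing
   S-part is already excluded by the first inequality).
   For S = {} the cone is empty and the value, built from Inf {}, is meaningless. *)
definition phi_str :: "real ^ 'p ^ 'n \<Rightarrow> real \<Rightarrow> 'p set \<Rightarrow> real" where
  "phi_str X L S =
     sqrt (INF d\<in>re_cone L S. (1 / real CARD('n) * (norm (X *v d))\<^sup>2) / (norm d)\<^sup>2)"

definition noiseless_lasso :: "real ^ 'p ^ 'n \<Rightarrow> real ^ 'p \<Rightarrow> real \<Rightarrow> real ^ 'p \<Rightarrow> real" where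
  "noiseless_lasso X b0 lam b =
     1 / real CARD('n) * (norm (X *v b - X *v b0))\<^sup>2 + lam * l1_norm b"

end

theory Submission
  imports Defs
begin

text \<open>Write \<open>d = \<beta>s - \<beta>0\<close>. Comparing the objective at \<open>\<beta>s\<close> and at \<open>\<beta>0\<close> gives the basic inequality
  \<open>\<parallel>X d\<parallel>\<^sup>2 / n \<le> lam (\<parallel>d\<^sub>S\<parallel>\<^sub>1 - \<parallel>d\<^sub>-\<^sub>S\<parallel>\<^sub>1)\<close>. It puts \<open>d\<close> in the cone for every \<open>L \<ge> 1\<close>, so the restricted
  eigenvalue bounds the left-hand side from below by \<open>\<phi>\<^sup>2 \<parallel>d\<parallel>\<^sup>2\<close>, while Cauchy-Schwarz bounds the
  right-hand side from above by \<open>lam sqrt s \<parallel>d\<parallel>\<close>.\<close>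

lemma l1_norm_nonneg: "0 \<le> l1_norm v"
  unfolding l1_norm_def by (intro sum_nonneg) simp

lemma l1_norm_eq_0_iff: "l1_norm v = 0 \<longleftrightarrow> v = 0"
  unfolding l1_norm_def by (subst sum_nonneg_eq_0_iff) (auto simp: vec_eq_iff)

lemma vec_on_add_vec_on_Compl: "vec_on S v + vec_on (- S) v = v"
  by (simp add: vec_on_def vec_eq_iff)

lemma l1_norm_vec_on: "l1_norm (vec_on S v) = (\<Sum>j\<in>S. \<bar>v $ j\<bar>)"
  unfolding l1_norm_def vec_on_def
  by (auto intro!: sum.mono_neutral_cong_right)

text \<open>Cauchy-Schwarz on \<open>S\<close> against the constant 1, whose L2 norm over
  \<open>S\<close> is \<open>sqrt (card S)\<close>.\<close>

lemma l1_norm_vec_on_le: "l1_norm (vec_on S v) \<le> sqrt (real (card S)) * norm v"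
proof -
  have "(\<Sum>j\<in>S. \<bar>1 :: real\<bar> * \<bar>v $ j\<bar>) \<le> L2_set (\<lambda>_. 1) S * L2_set (\<lambda>j. v $ j) S"
    by (rule L2_set_mult_ineq)
  also have "\<dots> \<le> L2_set (\<lambda>_. 1) S * L2_set (\<lambda>j. v $ j) UNIV"
    by (intro mult_left_mono L2_set_nonneg)
       (auto simp: L2_set_def intro!: real_sqrt_le_mono sum_mono2)
  also have "\<dots> = sqrt (real (card S)) * norm v"
    by (simp add: norm_vec_def L2_set_def)
  finally show ?thesis by (simp add: l1_norm_vec_on)
qed

text \<open>Holds coordinatewise: on the active set by the reverse triangle inequality, off it with
  equality because \<open>b\<close> vanishes there.\<close>

lemma l1_norm_diff_le_active_set:
  "l1_norm b - l1_norm b' \<le>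
     l1_norm (vec_on (active_set b) (b' - b)) - l1_norm (vec_on (- active_set b) (b' - b))"
proof -
  let ?S = "active_set b"
  have "l1_norm b - l1_norm b' = (\<Sum>j\<in>UNIV. \<bar>b $ j\<bar> - \<bar>b' $ j\<bar>)"
    by (simp add: l1_norm_def sum_subtractf)
  also have "\<dots> \<le> (\<Sum>j\<in>UNIV. \<bar>vec_on ?S (b' - b) $ j\<bar> - \<bar>vec_on (- ?S) (b' - b) $ j\<bar>)"
    by (intro sum_mono) (auto simp: vec_on_def active_set_def)
  finally show ?thesis by (simp add: l1_norm_def sum_subtractf)
qed

text \<open>The quadratic term vanishes at \<open>b0\<close>, so minimality of \<open>b\<close>
  bounds it by the difference of the penalties.\<close>

lemma noiseless_lasso_basic_inequality:
  fixes X :: "real ^ 'p ^ 'n"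
  assumes "lam \<ge> 0" and "is_arg_min (noiseless_lasso X b0 lam) (\<lambda>_. True) b"
  shows "1 / real CARD('n) * (norm (X *v (b - b0)))\<^sup>2 \<le>
    lam * (l1_norm (vec_on (active_set b0) (b - b0)) - l1_norm (vec_on (- active_set b0) (b - b0)))"
proof -
  have "noiseless_lasso X b0 lam b \<le> noiseless_lasso X b0 lam b0"
    using assms(2) by (auto simp: is_arg_min_linorder)
  then have "1 / real CARD('n) * (norm (X *v (b - b0)))\<^sup>2 \<le> lam * (l1_norm b0 - l1_norm b)"
    by (simp add: noiseless_lasso_def matrix_vector_mult_diff_distrib algebra_simps)
  also have "\<dots> \<le> lam * (l1_norm (vec_on (active_set b0) (b - b0))
      - l1_norm (vec_on (- active_set b0) (b - b0)))"
    using assms(1) by (intro mult_left_mono l1_norm_diff_le_active_set)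
  finally show ?thesis .
qed

lemma phi_str_le:
  fixes X :: "real ^ 'p ^ 'n"
  assumes "phi_str X L S > 0" and "d \<in> re_cone L S"
  shows "(phi_str X L S)\<^sup>2 * (norm d)\<^sup>2 \<le> 1 / real CARD('n) * (norm (X *v d))\<^sup>2"
proof -
  let ?q = "\<lambda>d. (1 / real CARD('n) * (norm (X *v d))\<^sup>2) / (norm d)\<^sup>2"
  have "bdd_below (?q ` re_cone L S)"
    by (rule bdd_belowI[of _ 0]) auto
  then have "(INF d\<in>re_cone L S. ?q d) \<le> ?q d"
    using assms(2) by (rule cINF_lower)
  \<comment> \<open>A positive root forces a positive infimum, so squaring undoes
    \<open>sqrt\<close>.\<close>
  moreover have "(phi_str X L S)\<^sup>2 = (INF d\<in>re_cone L S. ?q d)"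
    using assms(1) unfolding phi_str_def by simp
  moreover have "d \<noteq> 0"
    using assms(2) by (auto simp: re_cone_def l1_norm_vec_on)
  ultimately show ?thesis
    by (simp add: pos_le_divide_eq mult_ac)
qed

theorem theorem6:
  fixes X :: "real ^ 'p ^ 'n" and \<beta>0 \<beta>s :: "real ^ 'p" and lam L :: real
    and S :: "'p set" and s :: nat
  assumes "lam > 0"
    and "S = active_set \<beta>0"
    and "s = card S"
    and "L \<ge> 1"
    and "S \<noteq> {} \<Longrightarrow> phi_str X L S > 0"
    and "is_arg_min (noiseless_lasso X \<beta>0 lam) (\<lambda>_. True) \<beta>s"
  shows "(norm (\<beta>s - \<beta>0))\<^sup>2 \<le> real s * lam\<^sup>2 / (phi_str X L S) ^ 4"
proof (cases "\<beta>s = \<beta>0")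
  case False
  define d where "d = \<beta>s - \<beta>0"
  define \<phi> where "\<phi> = phi_str X L S"
  have basic: "1 / real CARD('n) * (norm (X *v d))\<^sup>2 \<le>
      lam * (l1_norm (vec_on S d) - l1_norm (vec_on (- S) d))"
    using noiseless_lasso_basic_inequality[of lam X \<beta>0 \<beta>s] assms by (simp add: d_def)
  have "0 \<le> 1 / real CARD('n) * (norm (X *v d))\<^sup>2"
    by simp
  then have "0 \<le> lam * (l1_norm (vec_on S d) - l1_norm (vec_on (- S) d))"
    using basic by linarith
  then have off: "l1_norm (vec_on (- S) d) \<le> l1_norm (vec_on S d)"
    using \<open>lam > 0\<close> by (simp add: zero_le_mult_iff)
  have on: "l1_norm (vec_on S d) \<noteq> 0"
  proof
    assume zero: "l1_norm (vec_on S d) = 0"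
    then have "l1_norm (vec_on (- S) d) = 0"
      using off l1_norm_nonneg[of "vec_on (- S) d"] by linarith
    with zero have "d = 0"
      using vec_on_add_vec_on_Compl[of S d] by (simp add: l1_norm_eq_0_iff)
    with False show False by (simp add: d_def)
  qed
  \<comment> \<open>An empty \<open>S\<close> would contradict \<open>on\<close>, so the eigenvalue
    hypothesis applies.\<close>
  have "\<phi> > 0"
    using assms(5) on by (cases "S = {}") (auto simp: \<phi>_def l1_norm_vec_on)
  \<comment> \<open>\<open>off\<close> is the cone condition with constant 1;
    \<open>L \<ge> 1\<close> relaxes it to \<open>L\<close>.\<close>
  have "l1_norm (vec_on S d) \<le> L * l1_norm (vec_on S d)"
    using mult_right_mono[OF \<open>L \<ge> 1\<close> l1_norm_nonneg[of "vec_on S d"]] by simp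
  with off on have "d \<in> re_cone L S"
    by (simp add: re_cone_def)
  then have "\<phi>\<^sup>2 * (norm d)\<^sup>2 \<le> 1 / real CARD('n) * (norm (X *v d))\<^sup>2"
    using phi_str_le \<open>\<phi> > 0\<close> unfolding \<phi>_def by blast
  also have "\<dots> \<le> lam * l1_norm (vec_on S d)"
    using basic \<open>lam > 0\<close> mult_left_mono[of "l1_norm (vec_on S d) - l1_norm (vec_on (- S) d)"
        "l1_norm (vec_on S d)" lam] l1_norm_nonneg[of "vec_on (- S) d"] by linarith
  also have "\<dots> \<le> lam * (sqrt (real s) * norm d)"
    using l1_norm_vec_on_le[of S d] \<open>lam > 0\<close> \<open>s = card S\<close> by simp
  finally have "(\<phi>\<^sup>2 * norm d) * norm d \<le> (lam * sqrt (real s)) * norm d"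
    by (simp add: power2_eq_square mult.assoc)
  \<comment> \<open>One factor \<open>norm d\<close> cancels since \<open>d\<close> is nonzero;
    squaring the rest produces \<open>\<phi> ^ 4\<close>.\<close>
  then have "\<phi>\<^sup>2 * norm d \<le> lam * sqrt (real s)"
    using False by (simp add: d_def)
  then have "(\<phi>\<^sup>2 * norm d)\<^sup>2 \<le> (lam * sqrt (real s))\<^sup>2"
    by (intro power_mono) auto
  then have "\<phi> ^ 4 * (norm d)\<^sup>2 \<le> real s * lam\<^sup>2"
    by (simp add: power_mult_distrib mult.commute flip: power_mult)
  then show ?thesis
    using \<open>\<phi> > 0\<close> by (simp add: \<phi>_def d_def pos_le_divide_eq mult.commute)
\<comment> \<open>In the case \<open>\<beta>s = \<beta>0\<close> the left-hand side is 0 and the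
  bound is nonnegative whatever \<open>phi_str\<close> is, with \<open>x / 0 = 0\<close>. An empty
  \<open>S\<close> always leads here.\<close>
qed simp

end
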